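(* Let $d_1,\dots,d_n$ be a sequence of possibly dependent, square-integrable real random variables, and let $e_1,\dots,e_n$ be a decoupled sequence of $d_1,\dots,d_n$ (with respect to an increasing sequence of $\sigma$-algebras $\{\mathcal{F}_i\}_{0\le i\le n}$ and given a $\sigma$-algebra $\mathcal{G}$). Then $$\mathbb{E}\left(\sum_{i=1}^n d_i\right)^2\le 2\,\mathbb{E}\left(\sum_{i=1}^n e_i\right)^2 .$$
   Context: All random variables are defined on a probability space $(\Omega,\mathcal{F},\mathbb{P})$ and are square-integrable. $\mathbb{E}(X)^2$ means $\mathbb{E}[X^2]$. $\mathcal{L}(X\mid\mathcal{H})$ denotes the conditional law of $X$ given a $\sigma$-algebra $\mathcal{H}$. Let $\mathcal{F}_0\subseteq\mathcal{F}_1\subseteq\dots\subseteq\mathcal{F}_n\subseteq\mathcal{F}$ be $\sigma$-algebras and let $\{d_i\}_{1\le i\le n}$, $\{e_i\}_{1\le i\le n}$ be sequences adapted to $\{\mathcal{F}_i\}$ (i.e. $d_i,e_i$ are $\mathcal{F}_i$-measurable). (Tangent) $\{d_i\}$ is tangent to $\{e_i\}$ with respect to $\{\mathcal{F}_i\}$ if $\mathcal{L}(d_i\mid\mathcal{F}_{i-1})=\mathcal{L}(e_i\mid\mathcal{F}_{i-1})$ for all $i$. (Conditionally independent, CI) $\{e_i\}$ is CI if there is a $\sigma$-algebra $\mathcal{G}\subseteq\mathcal{F}$ such that $e_1,\dots,e_n$ are conditionally independent given $\mathcal{G}$ and $\mathcal{L}(e_i\mid\mathcal{F}_{i-1})=\mathcal{L}(e_i\mid\mathcal{G})$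 for all $i$. (Decoupled) $\{e_i\}$ is a decoupled sequence (decoupled version) of $\{d_i\}$, given $\mathcal{G}$, if $\{e_i\}$ is CI with this $\mathcal{G}$ and is tangent to $\{d_i\}$ with respect to $\{\mathcal{F}_i\}$. *)

theory Defs
  imports "HOL-Probability.Probability"
begin

text \<open>
  Sub-\<open>\<sigma>\<close>-algebras are represented, as in the library, by measure spaces \<open>H\<close> with
  \<^term>\<open>subalgebra M H\<close>; only \<^term>\<open>sets H\<close> matters, the measure carried by \<open>H\<close> is ignored.
\<close>

definition square_integrable :: "'a measure \<Rightarrow> ('a \<Rightarrow> real) \<Rightarrow> bool" where
  "square_integrable M X \<longleftrightarrow>
     X \<in> borel_measurable M \<and> integrable M (\<lambda>\<omega>. (X \<omega>)\<^sup>2)"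

definition cond_prob_given :: "'a measure \<Rightarrow> 'a measure \<Rightarrow> 'a set \<Rightarrow> 'a \<Rightarrow> real" where
  "cond_prob_given M H A = real_cond_exp M H (indicator A)"

text \<open>
  The conditional law \<open>L(X | H)\<close>: the family \<open>B \<mapsto> P(X \<in> B | H)\<close>, indexed by the Borel sets.
  Each member is a random variable determined up to a null set, so two conditional laws, possibly
  given different \<open>\<sigma>\<close>-algebras, are equal if their members agree almost surely for every \<open>B\<close>.
\<close>

definition cond_law :: "'a measure \<Rightarrow> 'a measure \<Rightarrow> ('a \<Rightarrow> real) \<Rightarrow> real set \<Rightarrow> 'a \<Rightarrow> real" where
  "cond_law M H X B = cond_prob_given M H {\<omega> \<in> space M. X \<omega> \<in> B}"

definition cond_law_eq ::
  "'a measure \<Rightarrow> 'a measure \<Rightarrow> ('a \<Rightarrow> real) \<Rightarrow> 'a measure \<Rightarrow> ('a \<Rightarrow> real) \<Rightarrow> bool" where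
  "cond_law_eq M H X K Y \<longleftrightarrow>
     (\<forall>B \<in> sets borel. AE \<omega> in M. cond_law M H X B \<omega> = cond_law M K Y B \<omega>)"

definition cond_indep_vars ::
  "'a measure \<Rightarrow> 'a measure \<Rightarrow> (nat \<Rightarrow> 'a \<Rightarrow> real) \<Rightarrow> nat set \<Rightarrow> bool" where
  "cond_indep_vars M G X I \<longleftrightarrow>
     (\<forall>J B. J \<subseteq> I \<longrightarrow> J \<noteq> {} \<longrightarrow> finite J \<longrightarrow> (\<forall>j\<in>J. B j \<in> sets borel) \<longrightarrow>
       (AE \<omega> in M. cond_prob_given M G {\<omega> \<in> space M. \<forall>j\<in>J. X j \<omega> \<in> B j} \<omega>
          = (\<Prod>j\<in>J. cond_prob_given M G {\<omega> \<in> space M. X j \<omega> \<in> B j} \<omega>)))"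

text \<open>An increasing sequence \<open>F 0 \<subseteq> \<dots> \<subseteq> F n\<close> of sub-\<open>\<sigma>\<close>-algebras of \<open>M\<close>;
  \<open>F i\<close> is irrelevant for \<open>i > n\<close>.\<close>

definition finite_filtration :: "'a measure \<Rightarrow> nat \<Rightarrow> (nat \<Rightarrow> 'a measure) \<Rightarrow> bool" where
  "finite_filtration M n F \<longleftrightarrow>
     (\<forall>i\<le>n. subalgebra M (F i)) \<and> (\<forall>i<n. subalgebra (F (Suc i)) (F i))"

definition adapted_seq ::
  "nat \<Rightarrow> (nat \<Rightarrow> 'a measure) \<Rightarrow> (nat \<Rightarrow> 'a \<Rightarrow> real) \<Rightarrow> bool" where
  "adapted_seq n F X \<longleftrightarrow> (\<forall>i\<in>{1..n}. X i \<in> borel_measurable (F i))"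

definition tangent_seq :: "'a measure \<Rightarrow> nat \<Rightarrow> (nat \<Rightarrow> 'a measure) \<Rightarrow>
    (nat \<Rightarrow> 'a \<Rightarrow> real) \<Rightarrow> (nat \<Rightarrow> 'a \<Rightarrow> real) \<Rightarrow> bool" where
  "tangent_seq M n F d e \<longleftrightarrow>
     (\<forall>i\<in>{1..n}. cond_law_eq M (F (i - 1)) (d i) (F (i - 1)) (e i))"

definition CI_given :: "'a measure \<Rightarrow> nat \<Rightarrow> (nat \<Rightarrow> 'a measure) \<Rightarrow> 'a measure \<Rightarrow>
    (nat \<Rightarrow> 'a \<Rightarrow> real) \<Rightarrow> bool" where
  "CI_given M n F G e \<longleftrightarrow>
     subalgebra M G \<and> cond_indep_vars M G e {1..n} \<and>
     (\<forall>i\<in>{1..n}. cond_law_eq M (F (i - 1)) (e i) G (e i))"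

definition decoupled_seq :: "'a measure \<Rightarrow> nat \<Rightarrow> (nat \<Rightarrow> 'a measure) \<Rightarrow> 'a measure \<Rightarrow>
    (nat \<Rightarrow> 'a \<Rightarrow> real) \<Rightarrow> (nat \<Rightarrow> 'a \<Rightarrow> real) \<Rightarrow> bool" where
  "decoupled_seq M n F G d e \<longleftrightarrow>
     adapted_seq n F d \<and> adapted_seq n F e \<and> CI_given M n F G e \<and> tangent_seq M n F d e"

end

theory Submission
  imports Defs
begin

text \<open>
  Put \<open>\<mu>\<^sub>i = E(d\<^sub>i | F\<^sub>i\<^sub>-\<^sub>1)\<close>; tangency and the CI property give \<open>\<mu>\<^sub>i = E(e\<^sub>i | G)\<close> almost surely.
  The differences \<open>d\<^sub>i - \<mu>\<^sub>i\<close> are orthogonal since they are martingale differences, the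
  \<open>e\<^sub>i - \<mu>\<^sub>i\<close> since they are conditionally independent and centered given \<open>G\<close>, and both families
  have the same second moments. Hence, by \<open>(x + y)\<^sup>2 \<le> 2 x\<^sup>2 + 2 y\<^sup>2\<close>,
  \<open>E(\<Sum>d\<^sub>i)\<^sup>2 \<le> 2 E(\<Sum>(d\<^sub>i - \<mu>\<^sub>i))\<^sup>2 + 2 E(\<Sum>\<mu>\<^sub>i)\<^sup>2 = 2 E(\<Sum>(e\<^sub>i - \<mu>\<^sub>i))\<^sup>2 + 2 E(\<Sum>\<mu>\<^sub>i)\<^sup>2\<close>, which is
  \<open>2 E(\<Sum>e\<^sub>i)\<^sup>2\<close> by orthogonality of \<open>e\<^sub>i - \<mu>\<^sub>i\<close> to the \<open>G\<close>-measurable variables.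
\<close>


section \<open>Square-integrable variables and their products\<close>

lemma integrable_product_of_square_integrable:
  assumes "square_integrable M X" "square_integrable M Y"
  shows "integrable M (\<lambda>\<omega>. X \<omega> * Y \<omega>)"
proof (rule Bochner_Integration.integrable_bound)
  show "integrable M (\<lambda>\<omega>. (X \<omega>)\<^sup>2 + (Y \<omega>)\<^sup>2)"
    using assms by (simp add: square_integrable_def)
  show "(\<lambda>\<omega>. X \<omega> * Y \<omega>) \<in> borel_measurable M"
    using assms by (auto simp: square_integrable_def)
  have "\<bar>x * y\<bar> \<le> x\<^sup>2 + y\<^sup>2" for x y :: real
  proof -
    \<comment> \<open>The right-hand side expands to twice the difference of the two sides of the
      claim.\<close>
    have "0 \<le> (\<bar>x\<bar> - \<bar>y\<bar>)\<^sup>2 + x\<^sup>2 + y\<^sup>2"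
      by simp
    then show ?thesis
      by (simp add: power2_eq_square algebra_simps abs_mult)
  qed
  then show "AE \<omega> in M. norm (X \<omega> * Y \<omega>) \<le> norm ((X \<omega>)\<^sup>2 + (Y \<omega>)\<^sup>2)"
    by (simp add: abs_mult)
qed

lemma square_integrable_diff:
  assumes "square_integrable M X" "square_integrable M Y"
  shows "square_integrable M (\<lambda>\<omega>. X \<omega> - Y \<omega>)"
proof -
  have "integrable M (\<lambda>\<omega>. (X \<omega>)\<^sup>2 + (Y \<omega>)\<^sup>2 - 2 * (X \<omega> * Y \<omega>))"
    using assms integrable_product_of_square_integrable[OF assms]
    by (simp add: square_integrable_def)
  then show ?thesis
    using assms by (auto simp: square_integrable_def power2_diff mult.assoc)
qed

lemma (in finite_measure) square_integrable_bounded: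
  assumes "X \<in> borel_measurable M" "\<And>\<omega>. \<bar>X \<omega>\<bar> \<le> B"
  shows "square_integrable M X"
  unfolding square_integrable_def
proof (intro conjI integrable_const_bound[where B = "B\<^sup>2"] assms(1))
  show "AE \<omega> in M. norm ((X \<omega>)\<^sup>2) \<le> B\<^sup>2"
    using power_mono[OF assms(2) abs_ge_zero, of _ 2] by simp
qed (use assms(1) in measurable)

lemma (in finite_measure) square_integrable_indicator:
  "A \<in> sets M \<Longrightarrow> square_integrable M (indicator A)"
  by (rule square_integrable_bounded[where B = 1]) (auto simp: indicator_def)

lemma (in finite_measure) square_integrable_integrable:
  "square_integrable M X \<Longrightarrow> integrable M X"
  by (auto simp: square_integrable_def intro: square_integrable_imp_integrable)

lemma integral_square_sum:
  assumes "\<And>i. i \<in> I \<Longrightarrow> square_integrable M (X i)"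
  shows "integrable M (\<lambda>\<omega>. (\<Sum>i\<in>I. X i \<omega>)\<^sup>2)"
    and "(\<integral>\<omega>. (\<Sum>i\<in>I. X i \<omega>)\<^sup>2 \<partial>M) = (\<Sum>i\<in>I. \<Sum>j\<in>I. \<integral>\<omega>. X i \<omega> * X j \<omega> \<partial>M)"
proof -
  have "integrable M (\<lambda>\<omega>. X i \<omega> * X j \<omega>)" if "i \<in> I" "j \<in> I" for i j
    using assms[OF that(1)] assms[OF that(2)] by (rule integrable_product_of_square_integrable)
  then show "integrable M (\<lambda>\<omega>. (\<Sum>i\<in>I. X i \<omega>)\<^sup>2)"
    "(\<integral>\<omega>. (\<Sum>i\<in>I. X i \<omega>)\<^sup>2 \<partial>M) = (\<Sum>i\<in>I. \<Sum>j\<in>I. \<integral>\<omega>. X i \<omega> * X j \<omega> \<partial>M)"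
    by (simp_all add: power2_eq_square sum_product)
qed

text \<open>Carries identities about events over to identities about the variables: linearity
  extends \<open>eq\<close> to simple functions of \<open>X\<close> and \<open>Y\<close>, dominated
  convergence to \<open>X\<close> and \<open>Y\<close> themselves. The weights \<open>W\<close> and
  \<open>V\<close> leave room for the conditional expectations that appear in the
  applications.\<close>

lemma integral_mult_eq_of_indicators:
  fixes X W Y V :: "'a \<Rightarrow> real"
  assumes [measurable]: "X \<in> borel_measurable M" "Y \<in> borel_measurable M"
    and W: "integrable M W" "integrable M (\<lambda>\<omega>. X \<omega> * W \<omega>)"
    and V: "integrable M V" "integrable M (\<lambda>\<omega>. Y \<omega> * V \<omega>)"
    and eq: "\<And>B. B \<in> sets borel \<Longrightarrow>
      (\<integral>\<omega>. indicator {\<omega> \<in> space M. X \<omega> \<in> B} \<omega> * W \<omega> \<partial>M)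
        = (\<integral>\<omega>. indicator {\<omega> \<in> space M. Y \<omega> \<in> B} \<omega> * V \<omega> \<partial>M)"
  shows "(\<integral>\<omega>. X \<omega> * W \<omega> \<partial>M) = (\<integral>\<omega>. Y \<omega> * V \<omega> \<partial>M)"
proof -
  \<comment> \<open>The identity on the reals is approximated, not \<open>X\<close> or
    \<open>Y\<close>, so that the same \<open>s k\<close>, with the same level sets, can be composed
    with both.\<close>
  obtain s :: "nat \<Rightarrow> real \<Rightarrow> real" where simple: "\<And>k. simple_function borel (s k)"
    and lim: "\<And>x. (\<lambda>k. s k x) \<longlonglongrightarrow> x" and bound: "\<And>k x. \<bar>s k x\<bar> \<le> 2 * \<bar>x\<bar>"
    using borel_measurable_implies_sequence_metric[of "\<lambda>x::real. x" borel 0] by auto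
  have [measurable]: "s k \<in> borel_measurable borel" for k
    by (rule borel_measurable_simple_function[OF simple])
  have fin: "finite (range (s k))" for k
    using simple_functionD(1)[OF simple, of k] by simp
  have lvl: "s k -` {c} \<in> sets borel" for k c
    using simple_functionD(2)[OF simple, of k "{c}"] by simp
  \<comment> \<open>Decomposition along the finitely many level sets of \<open>s k\<close>. Outside
    \<open>space M\<close> all the indicators vanish, hence the restriction on
    \<open>\<omega>\<close>.\<close>
  have rep: "s k (Z \<omega>) * U \<omega>
      = (\<Sum>c\<in>range (s k). c * (indicator {\<omega> \<in> space M. Z \<omega> \<in> s k -` {c}} \<omega> * U \<omega>))"
    if "\<omega> \<in> space M" for k \<omega> and Z U :: "'a \<Rightarrow> real"
  proof -
    have "(\<Sum>c\<in>range (s k). c * (indicator {\<omega> \<in> space M. Z \<omega> \<in> s k -` {c}} \<omega> * U \<omega>))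
        = (\<Sum>c\<in>range (s k). if c = s k (Z \<omega>) then c * U \<omega> else 0)"
      using that by (intro sum.cong) (auto simp: indicator_def)
    then show ?thesis
      using fin by simp
  qed
  have expand: "(\<integral>\<omega>. s k (Z \<omega>) * U \<omega> \<partial>M)
      = (\<Sum>c\<in>range (s k). c * (\<integral>\<omega>. indicator {\<omega> \<in> space M. Z \<omega> \<in> s k -` {c}} \<omega> * U \<omega> \<partial>M))"
    if [measurable]: "Z \<in> borel_measurable M" and U: "integrable M U"
    for k and Z U :: "'a \<Rightarrow> real"
  proof -
    have "{\<omega> \<in> space M. Z \<omega> \<in> s k -` {c}} \<in> sets M" for c
      using lvl[of k c] by measurable
    then have int: "integrable M (\<lambda>\<omega>. indicator {\<omega> \<in> space M. Z \<omega> \<in> s k -` {c}} \<omega> * U \<omega>)" for c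
      using integrable_mult_indicator[OF _ U] by simp
    show ?thesis
      by (subst Bochner_Integration.integral_cong[OF refl rep]) (use int in simp_all)
  qed
  have conv: "(\<lambda>k. \<integral>\<omega>. s k (Z \<omega>) * U \<omega> \<partial>M) \<longlonglongrightarrow> (\<integral>\<omega>. Z \<omega> * U \<omega> \<partial>M)"
    if [measurable]: "Z \<in> borel_measurable M" "integrable M U"
      and ZU: "integrable M (\<lambda>\<omega>. Z \<omega> * U \<omega>)" for Z U :: "'a \<Rightarrow> real"
  proof (rule integral_dominated_convergence[where w = "\<lambda>\<omega>. 2 * \<bar>Z \<omega> * U \<omega>\<bar>"])
    show "AE \<omega> in M. (\<lambda>k. s k (Z \<omega>) * U \<omega>) \<longlonglongrightarrow> Z \<omega> * U \<omega>"
      by (intro AE_I2 tendsto_mult lim tendsto_const)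
    show "AE \<omega> in M. norm (s k (Z \<omega>) * U \<omega>) \<le> 2 * \<bar>Z \<omega> * U \<omega>\<bar>" for k
      using mult_right_mono[OF bound] by (simp add: abs_mult mult.assoc[symmetric])
  qed (use ZU in auto)
  have eq_k: "(\<integral>\<omega>. s k (X \<omega>) * W \<omega> \<partial>M) = (\<integral>\<omega>. s k (Y \<omega>) * V \<omega> \<partial>M)" for k
    by (simp only: expand[OF assms(1) W(1)] expand[OF assms(2) V(1)] eq[OF lvl])
  show ?thesis
    by (rule LIMSEQ_unique[OF conv[OF assms(1) W] conv[OF assms(2) V, folded eq_k]])
qed


section \<open>Conditional expectation as an orthogonal projection in L2\<close>

context prob_space
begin

lemma subalgebra_sigma_finite:
  "subalgebra M H \<Longrightarrow> sigma_finite_subalgebra M H"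
  by (intro finite_measure_subalgebra_is_sigma_finite finite_measure_subalgebra.intro
      finite_measure_subalgebra_axioms.intro finite_measure_axioms)

text \<open>Jensen's inequality for the convex function \<open>x\<^sup>2\<close>.\<close>

lemma square_integrable_cond_exp:
  assumes H: "subalgebra M H" and X: "square_integrable M X"
  shows "square_integrable M (real_cond_exp M H X)"
proof -
  interpret H: sigma_finite_subalgebra M H
    by (rule subalgebra_sigma_finite[OF H])
  have "integrable M (\<lambda>\<omega>. (real_cond_exp M H X \<omega>)\<^sup>2)"
    using square_integrable_integrable[OF X] X
    by (intro H.integrable_convex_cond_exp[where I = UNIV and q = "\<lambda>x. x\<^sup>2"] convex_power2)
      (auto simp: square_integrable_def)
  then show ?thesis
    by (simp add: square_integrable_def)
qed

text \<open>An \<open>H\<close>-measurable factor can be pulled into the conditional expectation. In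
  L2 terms, \<open>Y\<close> minus its projection is orthogonal to every square-integrable
  \<open>H\<close>-measurable variable.\<close>

lemma integral_mult_cond_exp:
  assumes H: "subalgebra M H" and X: "square_integrable M X" and Y: "square_integrable M Y"
    and XH: "X \<in> borel_measurable H"
  shows "(\<integral>\<omega>. X \<omega> * real_cond_exp M H Y \<omega> \<partial>M) = (\<integral>\<omega>. X \<omega> * Y \<omega> \<partial>M)"
proof -
  interpret H: sigma_finite_subalgebra M H
    by (rule subalgebra_sigma_finite[OF H])
  show ?thesis
    using Y integrable_product_of_square_integrable[OF X Y] XH
    by (intro H.real_cond_exp_intg(2)) (auto simp: square_integrable_def)
qed

lemma integral_cond_exp_mult_cond_exp:
  assumes H: "subalgebra M H" and X: "square_integrable M X" and Y: "square_integrable M Y"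
  shows "(\<integral>\<omega>. real_cond_exp M H X \<omega> * real_cond_exp M H Y \<omega> \<partial>M)
    = (\<integral>\<omega>. real_cond_exp M H X \<omega> * Y \<omega> \<partial>M)"
  by (rule integral_mult_cond_exp[OF H square_integrable_cond_exp[OF H X] Y]) simp

text \<open>Both sides equal the integral of the product of the two conditional expectations, which
  is symmetric in \<open>X\<close> and \<open>Y\<close>.\<close>

lemma cond_exp_self_adjoint:
  assumes "subalgebra M H" "square_integrable M X" "square_integrable M Y"
  shows "(\<integral>\<omega>. real_cond_exp M H X \<omega> * Y \<omega> \<partial>M) = (\<integral>\<omega>. X \<omega> * real_cond_exp M H Y \<omega> \<partial>M)"
  using integral_cond_exp_mult_cond_exp[OF assms]
    integral_cond_exp_mult_cond_exp[OF assms(1,3,2)]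
  by (simp add: mult.commute)

section \<open>Consequences of equal conditional laws\<close>

text \<open>The expectation of a conditional probability is the unconditional probability, whichever
  \<sigma>-algebra is given. This is what makes the second moments of tangent variables
  agree.\<close>

lemma cond_law_eq_distr:
  assumes H: "subalgebra M H" and K: "subalgebra M K"
    and [measurable]: "X \<in> borel_measurable M" "Y \<in> borel_measurable M"
    and law: "cond_law_eq M H X K Y"
  shows "distr M borel X = distr M borel Y"
proof (rule measure_eqI)
  fix B :: "real set"
  assume "B \<in> sets (distr M borel X)"
  then have [measurable]: "B \<in> sets borel"
    by simp
  have int: "integrable M (indicator {\<omega> \<in> space M. Z \<omega> \<in> B} :: 'a \<Rightarrow> real)"
    if [measurable]: "Z \<in> borel_measurable M" for Z :: "'a \<Rightarrow> real"
    by (intro square_integrable_integrable square_integrable_indicator) measurable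
  interpret H: sigma_finite_subalgebra M H
    by (rule subalgebra_sigma_finite[OF H])
  interpret K: sigma_finite_subalgebra M K
    by (rule subalgebra_sigma_finite[OF K])
  have "(\<integral>\<omega>. cond_law M H X B \<omega> \<partial>M) = (\<integral>\<omega>. cond_law M K Y B \<omega> \<partial>M)"
    using law by (intro integral_cong_AE) (auto simp: cond_law_eq_def cond_law_def cond_prob_given_def)
  then have "prob {\<omega> \<in> space M. X \<omega> \<in> B} = prob {\<omega> \<in> space M. Y \<omega> \<in> B}"
    by (simp add: cond_law_def cond_prob_given_def H.real_cond_exp_int(2) K.real_cond_exp_int(2) int)
  then show "emeasure (distr M borel X) B = emeasure (distr M borel Y) B"
    by (simp add: emeasure_distr emeasure_eq_measure vimage_def Int_def conj_commute)
qed simp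

text \<open>Equal conditional laws speak of events only. To reach the means, both sides are
  integrated over an arbitrary \<open>A\<close>, and self-adjointness moves the conditioning onto
  the indicator of \<open>A\<close>. What remains is an identity with fixed weights
  \<open>?W\<close> and \<open>?V\<close>, which can be tested on the events
  \<open>X \<in> B\<close> and \<open>Y \<in> B\<close>.\<close>

lemma cond_law_eq_cond_exp:
  assumes H: "subalgebra M H" and K: "subalgebra M K"
    and X: "square_integrable M X" and Y: "square_integrable M Y"
    and law: "cond_law_eq M H X K Y"
  shows "AE \<omega> in M. real_cond_exp M H X \<omega> = real_cond_exp M K Y \<omega>"
proof (rule density_unique_real)
  have [measurable]: "X \<in> borel_measurable M" "Y \<in> borel_measurable M"
    using X Y by (auto simp: square_integrable_def)
  show "integrable M (real_cond_exp M H X)" "integrable M (real_cond_exp M K Y)"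
    using H K X Y by (auto intro: square_integrable_integrable square_integrable_cond_exp)
  fix A
  assume A: "A \<in> sets M"
  let ?W = "real_cond_exp M H (indicator A)" and ?V = "real_cond_exp M K (indicator A)"
  have ind: "square_integrable M (indicator A)"
    using A by (rule square_integrable_indicator)
  have W: "square_integrable M ?W" and V: "square_integrable M ?V"
    using H K ind by (auto intro: square_integrable_cond_exp)
  have "(\<integral>\<omega>. X \<omega> * ?W \<omega> \<partial>M) = (\<integral>\<omega>. Y \<omega> * ?V \<omega> \<partial>M)"
  proof (rule integral_mult_eq_of_indicators)
    fix B :: "real set"
    assume B[measurable]: "B \<in> sets borel"
    let ?x = "indicator {\<omega> \<in> space M. X \<omega> \<in> B} :: 'a \<Rightarrow> real"
      and ?y = "indicator {\<omega> \<in> space M. Y \<omega> \<in> B} :: 'a \<Rightarrow> real"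
    have x: "square_integrable M ?x" and y: "square_integrable M ?y"
      by (auto intro!: square_integrable_indicator)
    \<comment> \<open>For events the hypothesis applies directly; self-adjointness then moves the
      conditioning from \<open>?x\<close> and \<open>?y\<close> to the indicator of
      \<open>A\<close>.\<close>
    have "AE \<omega> in M. real_cond_exp M H ?x \<omega> = real_cond_exp M K ?y \<omega>"
      using law B by (simp add: cond_law_eq_def cond_law_def cond_prob_given_def)
    then have "(\<integral>\<omega>. real_cond_exp M H ?x \<omega> * indicator A \<omega> \<partial>M)
        = (\<integral>\<omega>. real_cond_exp M K ?y \<omega> * indicator A \<omega> \<partial>M)"
      using A by (intro integral_cong_AE) auto
    then show "(\<integral>\<omega>. ?x \<omega> * ?W \<omega> \<partial>M) = (\<integral>\<omega>. ?y \<omega> * ?V \<omega> \<partial>M)"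
      by (simp add: cond_exp_self_adjoint[OF H x ind] cond_exp_self_adjoint[OF K y ind])
  qed (use W V X Y in \<open>auto intro: square_integrable_integrable
      integrable_product_of_square_integrable\<close>)
  then show "(\<integral>\<omega>\<in>A. real_cond_exp M H X \<omega> \<partial>M) = (\<integral>\<omega>\<in>A. real_cond_exp M K Y \<omega> \<partial>M)"
    using cond_exp_self_adjoint[OF H X ind] cond_exp_self_adjoint[OF K Y ind]
    by (simp add: set_lebesgue_integral_def mult.commute)
qed

section \<open>Products of conditionally independent variables\<close>

text \<open>Conditional independence gives the identity for indicators of events. The two indicators
  are then replaced by \<open>X i\<close> and \<open>X j\<close> one at a time. Only the integrated
  product rule is derived, since second moments require no more.\<close>

lemma cond_indep_integral_mult:
  assumes G: "subalgebra M G" and indep: "cond_indep_vars M G X I"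
    and ij: "i \<in> I" "j \<in> I" "i \<noteq> j"
    and Xi: "square_integrable M (X i)" and Xj: "square_integrable M (X j)"
  shows "(\<integral>\<omega>. X i \<omega> * X j \<omega> \<partial>M)
    = (\<integral>\<omega>. real_cond_exp M G (X i) \<omega> * real_cond_exp M G (X j) \<omega> \<partial>M)"
proof -
  interpret G: sigma_finite_subalgebra M G
    by (rule subalgebra_sigma_finite[OF G])
  have [measurable]: "X i \<in> borel_measurable M" "X j \<in> borel_measurable M"
    using Xi Xj by (auto simp: square_integrable_def)
  let ?i = "\<lambda>A. indicator {\<omega> \<in> space M. X i \<omega> \<in> A} :: 'a \<Rightarrow> real"
    and ?j = "\<lambda>B. indicator {\<omega> \<in> space M. X j \<omega> \<in> B} :: 'a \<Rightarrow> real"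
  have sq: "square_integrable M (?i A)" "square_integrable M (?j A)" if [measurable]: "A \<in> sets borel" for A
    by (auto intro!: square_integrable_indicator)
  have ce: "square_integrable M (real_cond_exp M G Z)" if "square_integrable M Z" for Z
    using G that by (rule square_integrable_cond_exp)
  have sets: "(\<integral>\<omega>. ?i A \<omega> * ?j B \<omega> \<partial>M) = (\<integral>\<omega>. ?i A \<omega> * real_cond_exp M G (?j B) \<omega> \<partial>M)"
    if [measurable]: "A \<in> sets borel" "B \<in> sets borel" for A B
  proof -
    let ?ij = "indicator {\<omega> \<in> space M. X i \<omega> \<in> A \<and> X j \<omega> \<in> B} :: 'a \<Rightarrow> real"
    have ij_sq: "integrable M ?ij"
      by (intro square_integrable_integrable square_integrable_indicator) measurable
    \<comment> \<open>As \<open>i\<close> and \<open>j\<close> are distinct, the choice of Borel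
      sets by \<open>if k = i\<close> is consistent and the product over \<open>{i, j}\<close> has
      exactly two factors.\<close>
    have "AE \<omega> in M. real_cond_exp M G ?ij \<omega> = real_cond_exp M G (?i A) \<omega> * real_cond_exp M G (?j B) \<omega>"
      using indep[unfolded cond_indep_vars_def, rule_format,
          of "{i, j}" "\<lambda>k. if k = i then A else B"] that ij
      by (simp add: cond_prob_given_def)
    then have "(\<integral>\<omega>. real_cond_exp M G ?ij \<omega> \<partial>M)
        = (\<integral>\<omega>. real_cond_exp M G (?i A) \<omega> * real_cond_exp M G (?j B) \<omega> \<partial>M)"
      by (intro integral_cong_AE) auto
    \<comment> \<open>One factor is already \<open>G\<close>-measurable, so the other may lose its
      conditioning.\<close>
    also have "\<dots> = (\<integral>\<omega>. ?i A \<omega> * real_cond_exp M G (?j B) \<omega> \<partial>M)"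
      using integral_cond_exp_mult_cond_exp[OF G sq(2) sq(1), OF that(2,1)] by (simp add: mult.commute)
    also have "(\<integral>\<omega>. real_cond_exp M G ?ij \<omega> \<partial>M) = (\<integral>\<omega>. ?i A \<omega> * ?j B \<omega> \<partial>M)"
      unfolding G.real_cond_exp_int(2)[OF ij_sq]
      by (intro Bochner_Integration.integral_cong) (auto simp: indicator_def)
    finally show ?thesis .
  qed
  \<comment> \<open>First replacement: \<open>X i\<close> for its indicators, with the event of
    \<open>X j\<close> kept fixed in the weights.\<close>
  have half: "(\<integral>\<omega>. X i \<omega> * ?j B \<omega> \<partial>M) = (\<integral>\<omega>. X i \<omega> * real_cond_exp M G (?j B) \<omega> \<partial>M)"
    if B: "B \<in> sets borel" for B
  proof (rule integral_mult_eq_of_indicators)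
    note j_sq = sq(2)[OF B] ce[OF sq(2)[OF B]]
    show "integrable M (?j B)" "integrable M (real_cond_exp M G (?j B))"
      using j_sq by (simp_all add: square_integrable_integrable)
    show "integrable M (\<lambda>\<omega>. X i \<omega> * ?j B \<omega>)"
      "integrable M (\<lambda>\<omega>. X i \<omega> * real_cond_exp M G (?j B) \<omega>)"
      using Xi j_sq by (simp_all add: integrable_product_of_square_integrable)
  qed (use sets[OF _ B] in simp_all)
  \<comment> \<open>Second replacement: now \<open>X i\<close> and its conditional expectation are
    the weights. Self-adjointness turns \<open>half\<close> into the required identity for the
    events of \<open>X j\<close>.\<close>
  have "(\<integral>\<omega>. X j \<omega> * X i \<omega> \<partial>M) = (\<integral>\<omega>. X j \<omega> * real_cond_exp M G (X i) \<omega> \<partial>M)"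
  proof (rule integral_mult_eq_of_indicators)
    fix B :: "real set"
    assume B: "B \<in> sets borel"
    show "(\<integral>\<omega>. ?j B \<omega> * X i \<omega> \<partial>M) = (\<integral>\<omega>. ?j B \<omega> * real_cond_exp M G (X i) \<omega> \<partial>M)"
      using half[OF B] cond_exp_self_adjoint[OF G Xi sq(2)[OF B]] by (simp add: mult.commute)
  qed (use Xi Xj ce[OF Xi] in \<open>simp_all add: square_integrable_integrable
      integrable_product_of_square_integrable\<close>)
  then show ?thesis
    using integral_cond_exp_mult_cond_exp[OF G Xi Xj] by (simp add: mult.commute)
qed

section \<open>Second moments of sums\<close>

text \<open>Pythagoras: the differences are pairwise orthogonal, and each is the residual of an
  orthogonal projection, whose squared norm is a difference of squared norms.\<close>

lemma integral_square_sum_martingale_differences: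
  assumes filt: "finite_filtration M n F"
    and sq: "\<And>i. i \<in> {1..n} \<Longrightarrow> square_integrable M (d i)"
    and adapt: "adapted_seq n F d"
  defines "\<mu> \<equiv> \<lambda>i. real_cond_exp M (F (i - 1)) (d i)"
  shows "(\<integral>\<omega>. (\<Sum>i=1..n. d i \<omega> - \<mu> i \<omega>)\<^sup>2 \<partial>M)
    = (\<Sum>i=1..n. (\<integral>\<omega>. (d i \<omega>)\<^sup>2 \<partial>M) - (\<integral>\<omega>. (\<mu> i \<omega>)\<^sup>2 \<partial>M))"
proof -
  let ?\<delta> = "\<lambda>i \<omega>. d i \<omega> - \<mu> i \<omega>"
  have sub: "subalgebra M (F i)" if "i \<le> n" for i
    using filt that by (simp add: finite_filtration_def)
  have mono: "subalgebra (F j) (F i)" if "i \<le> j" "j \<le> n" for i j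
    using that
  proof (induction j rule: dec_induct)
    case base
    then show ?case by (simp add: subalgebra_def)
  next
    case (step k)
    then have "subalgebra (F (Suc k)) (F k)"
      using filt by (simp add: finite_filtration_def)
    then show ?case
      using step by (auto simp: subalgebra_def)
  qed
  have sq_\<mu>: "square_integrable M (\<mu> i)" if "i \<in> {1..n}" for i
    using that sub sq by (auto simp: \<mu>_def intro!: square_integrable_cond_exp)
  have sq_\<delta>: "square_integrable M (?\<delta> i)" if "i \<in> {1..n}" for i
    using sq[OF that] sq_\<mu>[OF that] by (rule square_integrable_diff)
  \<comment> \<open>The strict inequality gives \<open>i \<le> j - 1\<close>, so the whole of
    \<open>F i\<close> is known one step before \<open>j\<close>.\<close>
  have meas: "?\<delta> i \<in> borel_measurable (F (j - 1))" if "i \<in> {1..n}" "j \<in> {1..n}" "i < j" for i j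
  proof (intro borel_measurable_diff)
    have "d i \<in> borel_measurable (F i)"
      using adapt that by (simp add: adapted_seq_def)
    then show "d i \<in> borel_measurable (F (j - 1))"
      using that by (intro measurable_from_subalg[OF mono[of i "j - 1"]]) auto
    show "\<mu> i \<in> borel_measurable (F (j - 1))"
      unfolding \<mu>_def using that
      by (intro measurable_from_subalg[OF mono[of "i - 1" "j - 1"]]) auto
  qed
  \<comment> \<open>Being \<open>F (j - 1)\<close>-measurable, the earlier difference has the same
    inner product with \<open>d j\<close> as with its projection \<open>\<mu> j\<close>.\<close>
  have orth_less: "(\<integral>\<omega>. ?\<delta> i \<omega> * ?\<delta> j \<omega> \<partial>M) = 0" if "i \<in> {1..n}" "j \<in> {1..n}" "i < j" for i j
  proof -
    have "(\<integral>\<omega>. ?\<delta> i \<omega> * \<mu> j \<omega> \<partial>M) = (\<integral>\<omega>. ?\<delta> i \<omega> * d j \<omega> \<partial>M)"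
      using integral_mult_cond_exp[OF sub sq_\<delta>[OF that(1)] sq[OF that(2)] meas[OF that]] that
      by (simp add: \<mu>_def)
    then show ?thesis
      using that sq sq_\<mu> sq_\<delta>
      by (simp add: right_diff_distrib[of "?\<delta> i _"] integrable_product_of_square_integrable)
  qed
  have orth: "(\<integral>\<omega>. ?\<delta> i \<omega> * ?\<delta> j \<omega> \<partial>M) = 0" if "i \<in> {1..n}" "j \<in> {1..n}" "i \<noteq> j" for i j
    using orth_less[of i j] orth_less[of j i] that by (cases "i < j") (auto simp: mult.commute)
  have diag: "(\<integral>\<omega>. ?\<delta> i \<omega> * ?\<delta> i \<omega> \<partial>M) = (\<integral>\<omega>. (d i \<omega>)\<^sup>2 \<partial>M) - (\<integral>\<omega>. (\<mu> i \<omega>)\<^sup>2 \<partial>M)"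
    if i: "i \<in> {1..n}" for i
  proof -
    have "(\<integral>\<omega>. \<mu> i \<omega> * \<mu> i \<omega> \<partial>M) = (\<integral>\<omega>. \<mu> i \<omega> * d i \<omega> \<partial>M)"
      unfolding \<mu>_def using i by (intro integral_cond_exp_mult_cond_exp sub sq) auto
    moreover have "(\<integral>\<omega>. ?\<delta> i \<omega> * ?\<delta> i \<omega> \<partial>M)
        = (\<integral>\<omega>. d i \<omega> * d i \<omega> - 2 * (\<mu> i \<omega> * d i \<omega>) + \<mu> i \<omega> * \<mu> i \<omega> \<partial>M)"
      by (intro Bochner_Integration.integral_cong) (auto simp: algebra_simps)
    ultimately show ?thesis
      using sq[OF i] sq_\<mu>[OF i]
      by (simp add: integrable_product_of_square_integrable power2_eq_square)
  qed
  have "(\<integral>\<omega>. (\<Sum>i=1..n. ?\<delta> i \<omega>)\<^sup>2 \<partial>M)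
      = (\<Sum>i=1..n. \<Sum>j=1..n. \<integral>\<omega>. ?\<delta> i \<omega> * ?\<delta> j \<omega> \<partial>M)"
    using sq_\<delta> by (rule integral_square_sum)
  also have "\<dots> = (\<Sum>i=1..n. \<Sum>j=1..n. if j = i then \<integral>\<omega>. ?\<delta> i \<omega> * ?\<delta> i \<omega> \<partial>M else 0)"
    using orth by (intro sum.cong) auto
  also have "\<dots> = (\<Sum>i=1..n. (\<integral>\<omega>. (d i \<omega>)\<^sup>2 \<partial>M) - (\<integral>\<omega>. (\<mu> i \<omega>)\<^sup>2 \<partial>M))"
    using diag by simp
  finally show ?thesis .
qed

text \<open>Both squared sums are expanded into double sums. Off the diagonal the terms for
  \<open>e\<close> and \<open>\<nu>\<close> agree by conditional independence; the diagonal supplies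
  the correction. This yields the second moment without centering the \<open>e i\<close>.\<close>

lemma integral_square_sum_cond_indep:
  assumes G: "subalgebra M G" and I: "finite I" and indep: "cond_indep_vars M G e I"
    and sq: "\<And>i. i \<in> I \<Longrightarrow> square_integrable M (e i)"
  defines "\<nu> \<equiv> \<lambda>i. real_cond_exp M G (e i)"
  shows "(\<integral>\<omega>. (\<Sum>i\<in>I. e i \<omega>)\<^sup>2 \<partial>M) = (\<integral>\<omega>. (\<Sum>i\<in>I. \<nu> i \<omega>)\<^sup>2 \<partial>M)
    + (\<Sum>i\<in>I. (\<integral>\<omega>. (e i \<omega>)\<^sup>2 \<partial>M) - (\<integral>\<omega>. (\<nu> i \<omega>)\<^sup>2 \<partial>M))"
proof -
  have sq_\<nu>: "square_integrable M (\<nu> i)" if "i \<in> I" for i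
    unfolding \<nu>_def using G sq[OF that] by (rule square_integrable_cond_exp)
  have "(\<integral>\<omega>. (\<Sum>i\<in>I. e i \<omega>)\<^sup>2 \<partial>M) = (\<Sum>i\<in>I. \<Sum>j\<in>I. \<integral>\<omega>. e i \<omega> * e j \<omega> \<partial>M)"
    using sq by (rule integral_square_sum)
  also have "\<dots> = (\<Sum>i\<in>I. \<Sum>j\<in>I. (\<integral>\<omega>. \<nu> i \<omega> * \<nu> j \<omega> \<partial>M)
      + (if j = i then (\<integral>\<omega>. (e i \<omega>)\<^sup>2 \<partial>M) - (\<integral>\<omega>. (\<nu> i \<omega>)\<^sup>2 \<partial>M) else 0))"
    using cond_indep_integral_mult[OF G indep] sq
    by (intro sum.cong) (auto simp: \<nu>_def power2_eq_square)
  also have "\<dots> = (\<Sum>i\<in>I. \<Sum>j\<in>I. \<integral>\<omega>. \<nu> i \<omega> * \<nu> j \<omega> \<partial>M)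
      + (\<Sum>i\<in>I. (\<integral>\<omega>. (e i \<omega>)\<^sup>2 \<partial>M) - (\<integral>\<omega>. (\<nu> i \<omega>)\<^sup>2 \<partial>M))"
    using I by (simp add: sum.distrib)
  also have "(\<Sum>i\<in>I. \<Sum>j\<in>I. \<integral>\<omega>. \<nu> i \<omega> * \<nu> j \<omega> \<partial>M) = (\<integral>\<omega>. (\<Sum>i\<in>I. \<nu> i \<omega>)\<^sup>2 \<partial>M)"
    using integral_square_sum(2)[of I M \<nu>, OF sq_\<nu>] by simp
  finally show ?thesis .
qed

end

section \<open>The decoupling inequality\<close>

theorem theorem3p1:
  fixes M G :: "'a measure" and F :: "nat \<Rightarrow> 'a measure"
    and d e :: "nat \<Rightarrow> 'a \<Rightarrow> real" and n :: nat
  assumes "prob_space M"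
    and "finite_filtration M n F"
    and "\<And>i. i \<in> {1..n} \<Longrightarrow> square_integrable M (d i)"
    and "\<And>i. i \<in> {1..n} \<Longrightarrow> square_integrable M (e i)"
    and "decoupled_seq M n F G d e"
  shows "(\<integral>\<omega>. (\<Sum>i=1..n. d i \<omega>)\<^sup>2 \<partial>M) \<le> 2 * (\<integral>\<omega>. (\<Sum>i=1..n. e i \<omega>)\<^sup>2 \<partial>M)"
proof -
  interpret prob_space M by fact
  note sq_d = assms(3) and sq_e = assms(4)
  have adapt: "adapted_seq n F d" and G: "subalgebra M G" and indep: "cond_indep_vars M G e {1..n}"
    and law_e: "\<And>i. i \<in> {1..n} \<Longrightarrow> cond_law_eq M (F (i - 1)) (e i) G (e i)"
    and law_d: "\<And>i. i \<in> {1..n} \<Longrightarrow> cond_law_eq M (F (i - 1)) (d i) (F (i - 1)) (e i)"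
    using assms(5) by (auto simp: decoupled_seq_def CI_given_def tangent_seq_def)
  have sub: "subalgebra M (F (i - 1))" if "i \<in> {1..n}" for i
    using assms(2) that by (auto simp: finite_filtration_def)
  define \<mu> where "\<mu> i = real_cond_exp M (F (i - 1)) (d i)" for i
  define \<nu> where "\<nu> i = real_cond_exp M G (e i)" for i
  have [measurable]: "\<mu> i \<in> borel_measurable M" "\<nu> i \<in> borel_measurable M" for i
    by (auto simp: \<mu>_def \<nu>_def)
  have sq_\<mu>: "square_integrable M (\<mu> i)" if "i \<in> {1..n}" for i
    unfolding \<mu>_def using sub[OF that] sq_d[OF that] by (rule square_integrable_cond_exp)
  \<comment> \<open>Two links: tangency passes from \<open>d i\<close> to \<open>e i\<close> under
    \<open>F (i - 1)\<close>, then the CI property passes from \<open>F (i - 1)\<close> to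
    \<open>G\<close>.\<close>
  have means: "AE \<omega> in M. \<mu> i \<omega> = \<nu> i \<omega>" if i: "i \<in> {1..n}" for i
    using cond_law_eq_cond_exp[OF sub[OF i] sub[OF i] sq_d[OF i] sq_e[OF i] law_d[OF i]]
      cond_law_eq_cond_exp[OF sub[OF i] G sq_e[OF i] sq_e[OF i] law_e[OF i]]
    unfolding \<mu>_def \<nu>_def by eventually_elim simp
  have sum_means: "(\<integral>\<omega>. (\<Sum>i=1..n. \<mu> i \<omega>)\<^sup>2 \<partial>M) = (\<integral>\<omega>. (\<Sum>i=1..n. \<nu> i \<omega>)\<^sup>2 \<partial>M)"
  proof (rule integral_cong_AE)
    have "AE \<omega> in M. \<forall>i\<in>{1..n}. \<mu> i \<omega> = \<nu> i \<omega>"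
      using means by (simp add: AE_finite_all)
    then show "AE \<omega> in M. (\<Sum>i=1..n. \<mu> i \<omega>)\<^sup>2 = (\<Sum>i=1..n. \<nu> i \<omega>)\<^sup>2"
      by eventually_elim simp
  qed measurable
  have mean_squares: "(\<integral>\<omega>. (\<mu> i \<omega>)\<^sup>2 \<partial>M) = (\<integral>\<omega>. (\<nu> i \<omega>)\<^sup>2 \<partial>M)" if "i \<in> {1..n}" for i
    using means[OF that] by (intro integral_cong_AE) auto
  \<comment> \<open>Tangent variables have the same law, and the second moment is an integral
    against that law.\<close>
  have squares: "(\<integral>\<omega>. (d i \<omega>)\<^sup>2 \<partial>M) = (\<integral>\<omega>. (e i \<omega>)\<^sup>2 \<partial>M)" if i: "i \<in> {1..n}" for i
  proof -
    have [measurable]: "d i \<in> borel_measurable M" "e i \<in> borel_measurable M"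
      using sq_d[OF i] sq_e[OF i] by (auto simp: square_integrable_def)
    have "distr M borel (d i) = distr M borel (e i)"
      by (rule cond_law_eq_distr[OF sub[OF i] sub[OF i] _ _ law_d[OF i]]) measurable
    then have "(\<integral>x. x\<^sup>2 \<partial>distr M borel (d i)) = (\<integral>x. x\<^sup>2 \<partial>distr M borel (e i))"
      by simp
    then show ?thesis
      by (simp add: integral_distr)
  qed
  let ?D = "\<lambda>\<omega>. \<Sum>i=1..n. d i \<omega> - \<mu> i \<omega>" and ?S = "\<lambda>\<omega>. \<Sum>i=1..n. \<mu> i \<omega>"
  have int_D: "integrable M (\<lambda>\<omega>. (?D \<omega>)\<^sup>2)" and int_S: "integrable M (\<lambda>\<omega>. (?S \<omega>)\<^sup>2)"
    using sq_d sq_\<mu> by (auto intro!: integral_square_sum(1) square_integrable_diff)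
  \<comment> \<open>The only estimate in the chain, and the source of the constant 2: the cross term
    of \<open>?D\<close> and \<open>?S\<close> need not vanish. All later steps are
    equalities.\<close>
  have "(\<integral>\<omega>. (\<Sum>i=1..n. d i \<omega>)\<^sup>2 \<partial>M) \<le> (\<integral>\<omega>. 2 * (?D \<omega>)\<^sup>2 + 2 * (?S \<omega>)\<^sup>2 \<partial>M)"
  proof (rule integral_mono)
    show "integrable M (\<lambda>\<omega>. (\<Sum>i=1..n. d i \<omega>)\<^sup>2)"
      using sq_d by (rule integral_square_sum(1))
    show "integrable M (\<lambda>\<omega>. 2 * (?D \<omega>)\<^sup>2 + 2 * (?S \<omega>)\<^sup>2)"
      using int_D int_S by simp
    show "(\<Sum>i=1..n. d i \<omega>)\<^sup>2 \<le> 2 * (?D \<omega>)\<^sup>2 + 2 * (?S \<omega>)\<^sup>2" for \<omega>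
    proof -
      have "(\<Sum>i=1..n. d i \<omega>) = ?D \<omega> + ?S \<omega>"
        by (simp add: sum_subtractf)
      moreover have "(x + y)\<^sup>2 \<le> 2 * x\<^sup>2 + 2 * y\<^sup>2" for x y :: real
        using zero_le_power2[of "x - y"] unfolding power2_sum power2_diff by linarith
      ultimately show ?thesis
        by presburger
    qed
  qed
  also have "\<dots> = 2 * ((\<integral>\<omega>. (?D \<omega>)\<^sup>2 \<partial>M) + (\<integral>\<omega>. (?S \<omega>)\<^sup>2 \<partial>M))"
    using int_D int_S by simp
  also have "(\<integral>\<omega>. (?D \<omega>)\<^sup>2 \<partial>M) = (\<Sum>i=1..n. (\<integral>\<omega>. (d i \<omega>)\<^sup>2 \<partial>M) - (\<integral>\<omega>. (\<mu> i \<omega>)\<^sup>2 \<partial>M))"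
    unfolding \<mu>_def using assms(2) sq_d adapt by (rule integral_square_sum_martingale_differences)
  also have "\<dots> = (\<Sum>i=1..n. (\<integral>\<omega>. (e i \<omega>)\<^sup>2 \<partial>M) - (\<integral>\<omega>. (\<nu> i \<omega>)\<^sup>2 \<partial>M))"
    using squares mean_squares by (intro sum.cong) auto
  \<comment> \<open>After \<open>\<mu>\<close> is exchanged for \<open>\<nu>\<close> in
    \<open>?S\<close>, the two terms are exactly the conditional independence decomposition for
    \<open>e\<close>.\<close>
  also have "\<dots> + (\<integral>\<omega>. (?S \<omega>)\<^sup>2 \<partial>M) = (\<integral>\<omega>. (\<Sum>i=1..n. e i \<omega>)\<^sup>2 \<partial>M)"
    unfolding sum_means \<nu>_def
    using integral_square_sum_cond_indep[OF G _ indep sq_e] by simp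
  finally show ?thesis .
qed

end
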